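(* Let $A$ be a finite set and $f(n)=\log\log n$. For $n\ge 3$, $m\ge 0$ and $x_1^n\in A^n$ define $$\phi_m(x_1^n)=\max_{m<k<f(n)}\ \max_{a_1^k\in A^k}\left[\hat P_n(a_k|a_1^{k-1})-\hat P_n(a_k|a_{k-m}^{k-1})\right]N_{n-1}(a_1^{k-1})$$ and $$M_n^{\#}(x_1^n)=\min\{m<n-f(n):\ \phi_m(x_1^n)<n^{3/4}\},$$ with $M_n^{\#}(x_1^n)=n$ if the set being minimized over is empty. Then $M_n^{\#}$ is a consistent Markov order estimator; that is, for every $M\ge0$ and every stationary ergodic $A$-valued process $X$ that is Markov of order $M$, $$\lim_{n\to\infty}M_n^{\#}(X_1^n)=M\quad\text{almost surely}.$$
   Context: $A$ is a finite set, $x_m^n$ denotes the sequence $x_m,x_{m+1},\dots,x_n$ with $x_i\in A$ (the empty sequence if $m>n$), and $\log$ is the natural logarithm. A stationary, ergodic, $A$-valued process $X=\{X_n\}_{n\ge1}$ with distribution $\mathbf P$ is Markov of order $0$ if it is i.i.d.; it is Markov of order $M>0$ if it is not i.i.d. and $M$ is the least positive integer such that $\mathbf P(a_{k+1}|a_1^k)=\mathbf P(a_{k+1}|a_{k-M+1}^k)$ for all $k\ge M$ and all $a_1^{k+1}$ (with $\mathbf P(a_1^k)>0$). Here $\mathbf P(a_1^k)=\mathrm{Prob}(X_1^k=a_1^k)$ and $\mathbf P(a_{k+1}|a_1^k)$ is the corresponding conditional probability of the next symbol. Empirical counts (overlapping blocks): $N_n(a_1^k)=N_n(a_1^k|x_1^n)=|\{i\in[0,n-k]: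 x_{i+1}^{i+k}=a_1^k\}|$; similarly $N_{n-1}(a_1^k)=|\{i\in[0,n-1-k]:x_{i+1}^{i+k}=a_1^k\}|$ (so for the empty block $N_{n-1}=n$). Empirical conditional probabilities: $\hat P_n(a_{k+1}|a_1^k)=N_n(a_1^{k+1})/N_{n-1}(a_1^k)$, and likewise $\hat P_n(a_k|a_{k-m}^{k-1})=N_n(a_{k-m}^{k})/N_{n-1}(a_{k-m}^{k-1})$. In the definition of $\phi_m$, terms with $N_{n-1}(a_1^{k-1})=0$ are taken to be $0$, and the maximum over an empty range of $k$ is taken to be $0$; $m$ and $k$ are integers. *)

theory Defs
  imports "HOL-Probability.Probability"
begin

text \<open>
  The alphabet is a finite type \<open>'a\<close>, blocks and samples are lists over it. A process
  \<open>X\<^sub>1, X\<^sub>2, \<dots>\<close> is a function \<open>X :: nat \<Rightarrow> 'w \<Rightarrow> 'a\<close> on a probability space; its value at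
  index 0 is never used.
\<close>

section \<open>Stationary ergodic processes\<close>

definition is_process :: "'w measure \<Rightarrow> (nat \<Rightarrow> 'w \<Rightarrow> 'a) \<Rightarrow> bool" where
  "is_process P X \<longleftrightarrow> prob_space P \<and> (\<forall>n\<ge>1. X n \<in> measurable P (count_space UNIV))"

definition seq_space :: "(nat \<Rightarrow> 'a) measure" where
  "seq_space = PiM UNIV (\<lambda>_. count_space UNIV)"

definition shift :: "(nat \<Rightarrow> 'a) \<Rightarrow> (nat \<Rightarrow> 'a)" where
  "shift x = (\<lambda>i. x (Suc i))"

text \<open>Coordinate \<open>i\<close> of the sequence space carries \<open>X\<^sub>i\<^sub>+\<^sub>1\<close>.\<close>

definition process_distr :: "'w measure \<Rightarrow> (nat \<Rightarrow> 'w \<Rightarrow> 'a) \<Rightarrow> (nat \<Rightarrow> 'a) measure" where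
  "process_distr P X = distr P seq_space (\<lambda>\<omega> i. X (Suc i) \<omega>)"

definition stationary :: "'w measure \<Rightarrow> (nat \<Rightarrow> 'w \<Rightarrow> 'a) \<Rightarrow> bool" where
  "stationary P X \<longleftrightarrow> distr (process_distr P X) seq_space shift = process_distr P X"

definition ergodic :: "'w measure \<Rightarrow> (nat \<Rightarrow> 'w \<Rightarrow> 'a) \<Rightarrow> bool" where
  "ergodic P X \<longleftrightarrow>
     (\<forall>B \<in> sets seq_space. shift -` B = B \<longrightarrow>
        measure (process_distr P X) B = 0 \<or> measure (process_distr P X) B = 1)"

section \<open>Markov order\<close>

definition sample :: "(nat \<Rightarrow> 'w \<Rightarrow> 'a) \<Rightarrow> nat \<Rightarrow> 'w \<Rightarrow> 'a list" where
  "sample X n \<omega> = map (\<lambda>i. X i \<omega>) [1..<Suc n]"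

definition block_prob :: "'w measure \<Rightarrow> (nat \<Rightarrow> 'w \<Rightarrow> 'a) \<Rightarrow> 'a list \<Rightarrow> real" where
  "block_prob P X a = \<P>(\<omega> in P. sample X (length a) \<omega> = a)"

definition next_prob :: "'w measure \<Rightarrow> (nat \<Rightarrow> 'w \<Rightarrow> 'a) \<Rightarrow> 'a \<Rightarrow> 'a list \<Rightarrow> real" where
  "next_prob P X b a = \<P>(\<omega> in P. X (Suc (length a)) \<omega> = b \<bar> sample X (length a) \<omega> = a)"

text \<open>
  The word \<open>drop (length a - m) a\<close> consists of the last \<open>m\<close> letters of \<open>a\<close>. As for every block,
  its probabilities are those of an occurrence starting at time 1.
\<close>

definition has_memory :: "'w measure \<Rightarrow> (nat \<Rightarrow> 'w \<Rightarrow> 'a) \<Rightarrow> nat \<Rightarrow> bool" where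
  "has_memory P X m \<longleftrightarrow>
     (\<forall>a b. length a \<ge> m \<longrightarrow> block_prob P X a > 0 \<longrightarrow>
        next_prob P X b a = next_prob P X b (drop (length a - m) a))"

definition iid :: "'w measure \<Rightarrow> (nat \<Rightarrow> 'w \<Rightarrow> 'a) \<Rightarrow> bool" where
  "iid P X \<longleftrightarrow>
     prob_space.indep_vars P (\<lambda>_. count_space UNIV) X {1..} \<and>
     (\<forall>n\<ge>1. distr P (count_space UNIV) (X n) = distr P (count_space UNIV) (X 1))"

definition markov_of_order :: "'w measure \<Rightarrow> (nat \<Rightarrow> 'w \<Rightarrow> 'a) \<Rightarrow> nat \<Rightarrow> bool" where
  "markov_of_order P X M \<longleftrightarrow>
     (if M = 0 then iid P X
      else \<not> iid P X \<and> has_memory P X M \<and> (\<forall>m. 0 < m \<and> m < M \<longrightarrow> \<not> has_memory P X m))"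

section \<open>The estimator\<close>

text \<open>
  \<open>block_count n xs a\<close> is the number of (overlapping) occurrences of \<open>a\<close> in the first \<open>n\<close>
  letters of \<open>xs\<close>. The empty block occurs \<open>n + 1\<close> times.
\<close>

definition block_count :: "nat \<Rightarrow> 'a list \<Rightarrow> 'a list \<Rightarrow> nat" where
  "block_count n xs a = card {i. i + length a \<le> n \<and> take (length a) (drop i xs) = a}"

definition emp_prob :: "'a list \<Rightarrow> 'a \<Rightarrow> 'a list \<Rightarrow> real" where
  "emp_prob xs b a =
     real (block_count (length xs) xs (a @ [b])) / real (block_count (length xs - 1) xs a)"

definition cutoff :: "nat \<Rightarrow> real" where
  "cutoff n = ln (ln (real n))"

text \<open>
  Below, the block \<open>a\<^sub>1, \<dots>, a\<^sub>k\<close> is split into \<open>butlast a\<close> and \<open>last a\<close>. The \<open>m\<close> letters before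
  the last one are \<open>drop (length a - 1 - m) (butlast a)\<close>. If \<open>butlast a\<close> has count 0, the last
  factor makes the term 0.
\<close>

definition phi_term :: "nat \<Rightarrow> 'a list \<Rightarrow> 'a list \<Rightarrow> real" where
  "phi_term m xs a =
     (emp_prob xs (last a) (butlast a) -
      emp_prob xs (last a) (drop (length a - 1 - m) (butlast a))) *
     real (block_count (length xs - 1) xs (butlast a))"

definition phi :: "nat \<Rightarrow> ('a::finite) list \<Rightarrow> real" where
  "phi m xs =
     (let K = {k. m < k \<and> real k < cutoff (length xs)} in
      if K = {} then 0
      else Max ((\<lambda>k. Max (phi_term m xs ` {a. length a = k})) ` K))"

definition order_estimator :: "('a::finite) list \<Rightarrow> nat" where
  "order_estimator xs =
     (let n = length xs;
          C = {m. real m < real n - cutoff n \<and> phi m xs < real n powr (3/4)}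
      in if C = {} then n else Min C)"

end

theory Submission
  imports Defs "HOL-Library.Sublist" "HOL-Real_Asymp.Real_Asymp"
begin

text \<open>
  If the process has memory \<open>m\<close>, then for a word \<open>a\<close> of length at least \<open>m\<close> and a letter \<open>c\<close> the
  count of \<open>a @ [c]\<close> minus \<open>p\<close> times the count of \<open>a\<close> is a martingale with bounded increments, where
  \<open>p\<close> is the probability of \<open>c\<close> after the last \<open>m\<close> letters of \<open>a\<close>. Its exponential moments give a tail bound
  \<open>exp (- sqrt n / 16)\<close> at level \<open>n powr (3/4) / 2\<close>. A term of \<open>phi m\<close> is at most the deviation for \<open>a\<close>
  minus a fraction of the one for its suffix of length \<open>m\<close>, with the same \<open>p\<close>. Only polylogarithmically
  many words are shorter than the cutoff, so by Borel-Cantelli \<open>phi m\<close> is eventually below the threshold.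
  If the process lacks memory \<open>m\<close>, some fixed word violates the memory condition; by the ergodic theorem
  its term in \<open>phi m\<close> grows linearly in \<open>n\<close> and exceeds the threshold.
\<close>

section \<open>The ergodic theorem\<close>

context prob_space
begin

text \<open>Garsia's argument. Where the running maximum \<open>F (Suc n)\<close> is positive,
  \<open>f\<close> dominates the difference between \<open>F (Suc n)\<close> and its composition
  with \<open>T\<close>; elsewhere that difference is at most 0. Its integral vanishes since
  \<open>T\<close> preserves the measure. By \<open>pos\<close> the sets where
  \<open>F (Suc n)\<close> is positive exhaust almost the whole space, so in the limit the full
  integral of \<open>f\<close> appears.\<close>

lemma maximal_ergodic:
  fixes f :: "'a \<Rightarrow> real"
  assumes T: "T \<in> measurable M M" "distr M M T = M"
    and f: "integrable M f"
    and pos: "AE x in M. \<exists>n. 0 < (\<Sum>i<n. f ((T ^^ i) x))"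
  shows "0 \<le> (\<integral>x. f x \<partial>M)"
proof -
  note T(1)[measurable]
  have [measurable]: "f \<in> borel_measurable M" using f by auto
  (* F n x is the maximum of the partial sums over 0, ..., n terms. *)
  define F where "F = rec_nat (\<lambda>x. 0) (\<lambda>n g x. max 0 (f x + g (T x)))"
  have F0: "F 0 x = 0" and FS: "F (Suc n) x = max 0 (f x + F n (T x))" for n x
    by (simp_all add: F_def)
  have F_nonneg: "0 \<le> F n x" for n x by (cases n) (simp_all add: F0 FS)
  have F_mono: "F n x \<le> F (Suc n) x" for n x
  proof (induction n arbitrary: x)
    case 0 then show ?case by (simp add: F0 FS)
  next
    case (Suc n) from Suc[of "T x"] show ?case by (simp add: FS)
  qed
  have [measurable]: "F n \<in> borel_measurable M" for n
  proof (induction n)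
    case 0 then show ?case by (simp add: F0[abs_def] cong: measurable_cong)
  next
    case (Suc n) note this[measurable] show ?case unfolding FS[abs_def] by measurable
  qed
  have int_T: "integrable M (\<lambda>x. g (T x))" "(\<integral>x. g (T x) \<partial>M) = (\<integral>x. g x \<partial>M)"
    if "integrable M g" for g :: "'a \<Rightarrow> real"
  proof -
    have [measurable]: "g \<in> borel_measurable M" using that by auto
    show "integrable M (\<lambda>x. g (T x))"
      using that integrable_distr[OF T(1), of g] by (simp add: T(2))
    show "(\<integral>x. g (T x) \<partial>M) = (\<integral>x. g x \<partial>M)"
      using integral_distr[OF T(1), of g] by (simp add: T(2))
  qed
  have F_int: "integrable M (F n)" for n
  proof (induction n)
    case 0 then show ?case by (simp add: F0[abs_def])
  next
    case (Suc n)
    have "integrable M (\<lambda>x. f x + F n (T x))"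
      using f int_T(1)[OF Suc] by (rule Bochner_Integration.integrable_add)
    then show ?case unfolding FS[abs_def] by (intro integrable_max) simp_all
  qed
  have S_le_F: "(\<Sum>i<n. f ((T ^^ i) x)) \<le> F n x" for n x
  proof (induction n arbitrary: x)
    case 0 then show ?case by (simp add: F0)
  next
    case (Suc n)
    have "(\<Sum>i<Suc n. f ((T ^^ i) x)) = f x + (\<Sum>i<n. f ((T ^^ i) (T x)))"
      by (simp only: sum.lessThan_Suc_shift) (simp add: funpow_swap1)
    then show ?case using Suc[of "T x"] by (simp add: FS)
  qed
  (* F is increasing in n, so F (Suc n) x <= f x + F (Suc n) (T x) wherever F (Suc n) x > 0. *)
  have step: "0 \<le> (\<integral>x. indicator {x. 0 < F (Suc n) x} x * f x \<partial>M)" for n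
  proof -
    have "0 = (\<integral>x. F (Suc n) x - F (Suc n) (T x) \<partial>M)"
      using int_T[OF F_int, of "Suc n"] F_int by simp
    also have "\<dots> \<le> (\<integral>x. indicator {x. 0 < F (Suc n) x} x * f x \<partial>M)"
    proof (rule integral_mono)
      show "integrable M (\<lambda>x. F (Suc n) x - F (Suc n) (T x))"
        using int_T[OF F_int, of "Suc n"] F_int by simp
      show "integrable M (\<lambda>x. indicator {x. 0 < F (Suc n) x} x * f x)"
        by (rule Bochner_Integration.integrable_bound[OF f]) (auto simp: indicator_def)
      fix x
      show "F (Suc n) x - F (Suc n) (T x) \<le> indicator {x. 0 < F (Suc n) x} x * f x"
        using F_mono[of n "T x"] F_nonneg[of "Suc n" "T x"] FS[of n x]
        by (cases "0 < F (Suc n) x") (auto simp: max_def split: if_splits)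
    qed
    finally show ?thesis .
  qed
  have "(\<lambda>n. \<integral>x. indicator {x. 0 < F (Suc n) x} x * f x \<partial>M) \<longlonglongrightarrow> (\<integral>x. f x \<partial>M)"
  proof (rule integral_dominated_convergence[where w = "\<lambda>x. norm (f x)"])
    show "AE x in M. (\<lambda>n. indicator {x. 0 < F (Suc n) x} x * f x) \<longlonglongrightarrow> f x"
      using pos
    proof eventually_elim
      case (elim x)
      then obtain k where k: "0 < (\<Sum>i<k. f ((T ^^ i) x))" by blast
      have "0 < F (Suc n) x" if "n \<ge> k" for n
      proof -
        have "F k x \<le> F (Suc n) x"
          by (rule lift_Suc_mono_le[where f = "\<lambda>n. F n x"]) (use F_mono that in auto)
        moreover have "(\<Sum>i<k. f ((T ^^ i) x)) \<le> F k x" by (rule S_le_F)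
        ultimately show ?thesis using k by linarith
      qed
      then have "\<forall>\<^sub>F n in sequentially. indicator {x. 0 < F (Suc n) x} x * f x = f x"
        by (auto intro!: eventually_sequentiallyI[of k])
      then show ?case by (rule tendsto_eventually)
    qed
  qed (use f in \<open>auto simp: indicator_def\<close>)
  then show ?thesis by (rule LIMSEQ_le_const) (use step in blast)
qed

text \<open>Were the sums unbounded with probability 1, almost every point would have a positive
  partial sum, and the maximal inequality would make the integral nonnegative.\<close>

lemma ergodic_sums_bounded_above:
  fixes f :: "'a \<Rightarrow> real"
  assumes T: "T \<in> measurable M M" "distr M M T = M"
    and erg: "\<And>B. B \<in> sets M \<Longrightarrow> T -` B \<inter> space M = B \<Longrightarrow> prob B = 0 \<or> prob B = 1"
    and f: "integrable M f" and neg: "(\<integral>x. f x \<partial>M) < 0"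
  shows "AE x in M. \<exists>K. \<forall>n. (\<Sum>i<n. f ((T ^^ i) x)) \<le> K"
proof -
  note T(1)[measurable]
  have [measurable]: "f \<in> borel_measurable M" using f by auto
  have [measurable]: "(T ^^ i) \<in> measurable M M" for i by (induction i) auto
  define S where "S n x = (\<Sum>i<n. f ((T ^^ i) x))" for n x
  have [measurable]: "S n \<in> borel_measurable M" for n unfolding S_def by measurable
  have S_Suc: "S (Suc n) x = f x + S n (T x)" for n x
    unfolding S_def by (simp only: sum.lessThan_Suc_shift) (simp add: funpow_swap1)
  (* The set of unbounded partial sums is exactly invariant, so ergodicity applies to it. *)
  define B where "B = {x \<in> space M. \<forall>k::nat. \<exists>n. real k < S n x}"
  have B_sets: "B \<in> sets M" unfolding B_def by measurable
  have unb_iff: "(\<forall>k::nat. \<exists>n. real k < S n (T x)) \<longleftrightarrow> (\<forall>k::nat. \<exists>n. real k < S n x)" (is "?L \<longleftrightarrow> ?R") for x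
  proof
    assume L: ?L
    show ?R
    proof
      fix k :: nat
      obtain j :: nat where "real k - f x \<le> real j" using real_arch_simple by blast
      moreover obtain n where "real j < S n (T x)" using L by blast
      ultimately have "real k < S (Suc n) x" by (simp add: S_Suc)
      then show "\<exists>n. real k < S n x" by blast
    qed
  next
    assume R: ?R
    show ?L
    proof
      fix k :: nat
      obtain j :: nat where j: "real k + \<bar>f x\<bar> \<le> real j" using real_arch_simple by blast
      obtain n where n: "real j < S n x" using R by blast
      then obtain n' where "n = Suc n'" by (cases n) (auto simp: S_def)
      then have "real k < S n' (T x)" using j n by (simp add: S_Suc)
      then show "\<exists>n. real k < S n (T x)" by blast
    qed
  qed
  have "T -` B \<inter> space M = B"
    using unb_iff measurable_space[OF T(1)] by (auto simp: B_def)
  then consider "prob B = 0" | "prob B = 1" using erg[OF B_sets] by blast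
  then have "AE x in M. x \<notin> B"
  proof cases
    case 1 then show ?thesis using B_sets by (simp add: AE_iff_measurable[OF B_sets] emeasure_eq_measure B_def cong: conj_cong)
  next
    case 2
    then have "AE x in M. x \<in> B" using B_sets by (simp add: prob_eq_1)
    then have "AE x in M. \<exists>n. 0 < (\<Sum>i<n. f ((T ^^ i) x))"
    proof eventually_elim
      case (elim x) 
      then have "\<exists>n. real 0 < S n x" unfolding B_def by blast
      then show ?case by (simp add: S_def)
    qed
    with maximal_ergodic[OF T f] neg show ?thesis by simp
  qed
  with AE_space show ?thesis
  proof eventually_elim
    case (elim x)
    then obtain k :: nat where "\<And>n. S n x \<le> real k" by (auto simp: B_def not_less)
    then show ?case by (auto simp: S_def)
  qed
qed

text \<open>Subtracting the mean plus \<open>1 / real (Suc k)\<close> makes the integral negative,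
  so the sums stay bounded and the bound divided by \<open>n\<close> vanishes. Countably many
  margins \<open>k\<close> leave a single null set for all \<open>e\<close>.\<close>

lemma birkhoff_upper:
  fixes f :: "'a \<Rightarrow> real"
  assumes T: "T \<in> measurable M M" "distr M M T = M"
    and erg: "\<And>B. B \<in> sets M \<Longrightarrow> T -` B \<inter> space M = B \<Longrightarrow> prob B = 0 \<or> prob B = 1"
    and f: "integrable M f"
  shows "AE x in M. \<forall>e>0. \<forall>\<^sub>F n in sequentially. (\<Sum>i<n. f ((T ^^ i) x)) / real n < (\<integral>x. f x \<partial>M) + e"
proof -
  define I where "I = (\<integral>x. f x \<partial>M)"
  have "AE x in M. \<forall>k. \<exists>K. \<forall>n. (\<Sum>i<n. f ((T ^^ i) x) - (I + 1 / real (Suc k))) \<le> K"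
    unfolding AE_all_countable
  proof
    fix k
    show "AE x in M. \<exists>K. \<forall>n. (\<Sum>i<n. f ((T ^^ i) x) - (I + 1 / real (Suc k))) \<le> K"
      by (rule ergodic_sums_bounded_above[OF T erg]) (use f in \<open>auto simp: I_def prob_space\<close>)
  qed
  then show ?thesis
  proof eventually_elim
    case (elim x)
    show ?case
    proof (intro allI impI)
      fix e :: real assume "0 < e"
      then obtain k where k: "1 / real (Suc k) < e / 2" using nat_approx_posE[of "e/2"] by auto
      obtain K where K: "\<And>n. (\<Sum>i<n. f ((T ^^ i) x) - (I + 1 / real (Suc k))) \<le> K"
        using elim by blast
      have "(\<lambda>n. K / real n) \<longlonglongrightarrow> 0" by real_asymp
      then have "\<forall>\<^sub>F n in sequentially. K / real n < e / 2"
        by (rule order_tendstoD) (use \<open>0 < e\<close> in simp)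
      then show "\<forall>\<^sub>F n in sequentially. (\<Sum>i<n. f ((T ^^ i) x)) / real n < (\<integral>x. f x \<partial>M) + e"
        using eventually_gt_at_top[of 0]
      proof eventually_elim
        case (elim n)
        have "(\<Sum>i<n. f ((T ^^ i) x)) \<le> real n * (I + 1 / real (Suc k)) + K"
          using K[of n] by (simp add: sum_subtractf)
        then have "(\<Sum>i<n. f ((T ^^ i) x)) / real n \<le> I + 1 / real (Suc k) + K / real n"
          using elim by (simp add: field_simps del: of_nat_Suc)
        with elim k show ?case unfolding I_def by linarith
      qed
    qed
  qed
qed

text \<open>The upper bound for \<open>f\<close> and the one for its negative squeeze the
  averages.\<close>

lemma birkhoff_ergodic:
  fixes f :: "'a \<Rightarrow> real"
  assumes T: "T \<in> measurable M M" "distr M M T = M"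
    and erg: "\<And>B. B \<in> sets M \<Longrightarrow> T -` B \<inter> space M = B \<Longrightarrow> prob B = 0 \<or> prob B = 1"
    and f: "integrable M f"
  shows "AE x in M. (\<lambda>n. (\<Sum>i<n. f ((T ^^ i) x)) / real n) \<longlonglongrightarrow> (\<integral>x. f x \<partial>M)"
proof -
  have "AE x in M. \<forall>e>0. \<forall>\<^sub>F n in sequentially. (\<Sum>i<n. - f ((T ^^ i) x)) / real n < (\<integral>x. - f x \<partial>M) + e"
    by (rule birkhoff_upper[OF T erg]) (use f in auto)
  moreover have "AE x in M. \<forall>e>0. \<forall>\<^sub>F n in sequentially. (\<Sum>i<n. f ((T ^^ i) x)) / real n < (\<integral>x. f x \<partial>M) + e"
    by (rule birkhoff_upper[OF T erg f])
  ultimately show ?thesis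
  proof eventually_elim
    case (elim x)
    define u where "u n = (\<Sum>i<n. f ((T ^^ i) x)) / real n" for n
    have lower: "- u n = (\<Sum>i<n. - f ((T ^^ i) x)) / real n" for n
      by (simp add: u_def sum_negf)
    have "u \<longlonglongrightarrow> (\<integral>x. f x \<partial>M)"
    proof (rule order_tendstoI)
      fix a assume "a < (\<integral>x. f x \<partial>M)"
      with elim(1)[rule_format, of "(\<integral>x. f x \<partial>M) - a"]
      show "\<forall>\<^sub>F n in sequentially. a < u n"
        unfolding lower[symmetric] by (auto elim: eventually_mono)
    next
      fix a assume "(\<integral>x. f x \<partial>M) < a"
      with elim(2)[rule_format, of "a - (\<integral>x. f x \<partial>M)"]
      show "\<forall>\<^sub>F n in sequentially. u n < a"
        unfolding u_def by (auto elim: eventually_mono)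
    qed
    then show ?case unfolding u_def .
  qed
qed

end

section \<open>Counting occurrences\<close>

text \<open>Occurrences are indexed by the position where they end instead of where they start, so
  that reading a further letter adds at most one of them.\<close>

lemma suffix_take_iff:
  assumes "j \<le> length w"
  shows "suffix a (take j w) \<longleftrightarrow> length a \<le> j \<and> take (length a) (drop (j - length a) w) = a"
proof
  assume "suffix a (take j w)"
  then obtain z where z: "take j w = z @ a" by (auto elim: suffixE)
  then have "length z + length a = j" using assms by (metis length_append length_take min.absorb2)
  moreover have "w = z @ a @ drop j w" by (metis append.assoc append_take_drop_id z)
  ultimately show "length a \<le> j \<and> take (length a) (drop (j - length a) w) = a"
    by (metis add_diff_cancel_right' append_eq_conv_conj le_add2)
next
  assume *: "length a \<le> j \<and> take (length a) (drop (j - length a) w) = a"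
  then have "drop (j - length a) (take j w) = a" by (simp add: drop_take)
  then show "suffix a (take j w)" by (metis suffix_drop)
qed

lemma block_count_eq_card_suffix:
  assumes "n < length w"
  shows "block_count n w a = card {j. j \<le> n \<and> suffix a (take j w)}"
  unfolding block_count_def
proof (rule bij_betw_same_card)
  show "bij_betw (\<lambda>i. i + length a) {i. i + length a \<le> n \<and> take (length a) (drop i w) = a}
     {j. j \<le> n \<and> suffix a (take j w)}"
    by (rule bij_betwI[where g = "\<lambda>j. j - length a"]) (use assms in \<open>auto simp: suffix_take_iff\<close>)
qed

text \<open>An occurrence of \<open>a @ [c]\<close> is recorded at the end \<open>j\<close> of its
  part \<open>a\<close>; with indices from 0, the letter that follows is
  \<open>w ! j\<close>.\<close>

lemma block_count_snoc_eq_card_suffix: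
  "block_count (length w) w (a @ [c]) = card {j. j < length w \<and> suffix a (take j w) \<and> w ! j = c}"
  unfolding block_count_def
proof (rule bij_betw_same_card)
  have *: "take (Suc (length a)) (drop i w) = a @ [d] \<longleftrightarrow> take (length a) (drop i w) = a \<and> w ! (i + length a) = d"
    if "i + length a < length w" for i d
    using that by (auto simp: take_Suc_conv_app_nth add.commute)
  show "bij_betw (\<lambda>i. i + length a)
     {i. i + length (a @ [c]) \<le> length w \<and> take (length (a @ [c])) (drop i w) = a @ [c]}
     {j. j < length w \<and> suffix a (take j w) \<and> w ! j = c}"
    by (rule bij_betwI[where g = "\<lambda>j. j - length a"]) (auto simp: suffix_take_iff *)
qed

text \<open>For \<open>p\<close> the conditional probability of \<open>c\<close> given the past,
  this is a martingale along the sample. Summing over time makes its increments visible, as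
  \<open>dev_snoc\<close> states.\<close>

definition dev :: "real \<Rightarrow> 'a list \<Rightarrow> 'a \<Rightarrow> 'a list \<Rightarrow> real" where
  "dev p a c w = (\<Sum>j<length w. if suffix a (take j w) then of_bool (w ! j = c) - p else 0)"

lemma dev_Nil [simp]: "dev p a c [] = 0"
  by (simp add: dev_def)

lemma dev_snoc: "dev p a c (w @ [b]) = dev p a c w + (if suffix a w then of_bool (b = c) - p else 0)"
  by (auto simp: dev_def nth_append intro!: sum.cong)

text \<open>An occurrence of \<open>a\<close> ending with the last letter of \<open>w\<close> has no
  successor and contributes no increment; hence the count of \<open>a\<close> runs over one letter
  less.\<close>

lemma dev_eq_block_count:
  assumes "w \<noteq> []"
  shows "dev p a c w = real (block_count (length w) w (a @ [c])) - p * real (block_count (length w - 1) w a)"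
proof -
  have 1: "block_count (length w - 1) w a = card {j. j < length w \<and> suffix a (take j w)}"
    using assms by (subst block_count_eq_card_suffix)
      (auto intro!: arg_cong[where f = card] simp: Suc_le_eq[symmetric] simp flip: length_greater_0_conv)
  have "dev p a c w = (\<Sum>j<length w. (of_bool (suffix a (take j w) \<and> w ! j = c) :: real))
      - p * (\<Sum>j<length w. of_bool (suffix a (take j w)))"
    unfolding dev_def sum_distrib_left sum_subtractf[symmetric]
    by (rule sum.cong) auto
  also have "\<dots> = real (card {j. j < length w \<and> suffix a (take j w) \<and> w ! j = c})
      - p * real (card {j. j < length w \<and> suffix a (take j w)})"
    by (simp add: sum_of_bool_eq Int_def)
  finally show ?thesis unfolding 1 block_count_snoc_eq_card_suffix .
qed

text \<open>Wherever \<open>a\<close> ends, its suffix \<open>s\<close> ends as well.\<close>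

lemma block_count_mono_suffix:
  assumes "n < length w" "suffix s a"
  shows "block_count n w a \<le> block_count n w s"
  unfolding block_count_eq_card_suffix[OF assms(1)]
  by (rule card_mono) (use assms(2) in \<open>auto intro: suffix_order.trans\<close>)

text \<open>With the same \<open>p\<close> centring both counts, the contributions of
  \<open>p\<close> cancel. What remains is the deviation of \<open>a\<close> minus
  \<open>Na / Ns\<close> times that of its suffix, and this ratio is at most 1.\<close>

lemma phi_term_le_dev:
  assumes "w \<noteq> []" and t: "0 < t"
    and d1: "dev p a c w < t" and d2: "- t < dev p (drop (length a - m) a) c w"
  shows "phi_term m w (a @ [c]) < 2 * t"
proof -
  define s where "s = drop (length a - m) a"
  define Na where "Na = real (block_count (length w - 1) w a)"
  define Ns where "Ns = real (block_count (length w - 1) w s)"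
  have "suffix s a" by (simp add: s_def suffix_drop)
  then have le: "Na \<le> Ns" "0 \<le> Na" unfolding Na_def Ns_def
    using block_count_mono_suffix[of "length w - 1" w s a] \<open>w \<noteq> []\<close> by simp_all
  show ?thesis
  proof (cases "Na = 0")
    case True
    then show ?thesis using t by (simp add: phi_term_def Na_def)
  next
    case False
    with le have pos: "0 < Na" "0 < Ns" by auto
    have "phi_term m w (a @ [c]) = (real (block_count (length w) w (a @ [c])) / Na - real (block_count (length w) w (s @ [c])) / Ns) * Na"
      by (simp add: phi_term_def emp_prob_def Na_def Ns_def s_def)
    also have "real (block_count (length w) w (a @ [c])) = dev p a c w + p * Na"
      using dev_eq_block_count[OF \<open>w \<noteq> []\<close>, of p a c] by (simp add: Na_def)
    also have "real (block_count (length w) w (s @ [c])) = dev p s c w + p * Ns"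
      using dev_eq_block_count[OF \<open>w \<noteq> []\<close>, of p s c] by (simp add: Ns_def)
    also have "((dev p a c w + p * Na) / Na - (dev p s c w + p * Ns) / Ns) * Na
      = dev p a c w + Na / Ns * (- dev p s c w)"
      using pos by (simp add: field_simps)
    also have "Na / Ns * (- dev p s c w) \<le> Na / Ns * t"
      by (rule mult_left_mono) (use d2 pos in \<open>auto simp: s_def\<close>)
    also have "\<dots> \<le> 1 * t" by (rule mult_right_mono) (use pos le t in auto)
    finally show ?thesis using d1 by simp
  qed
qed

section \<open>Elementary exponential inequalities\<close>

lemma exp_le_quadratic: "exp x \<le> 1 + x + x\<^sup>2" if "\<bar>x\<bar> \<le> 1" for x :: real
proof (cases "0 \<le> x")
  case True with that show ?thesis using exp_bound[of x] by simp
next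
  case False
  define y where "y = - x"
  have y: "0 \<le> y" "y \<le> 1" using False that by (auto simp: y_def)
  \<comment> \<open>The product equals \<open>1 + y^3\<close>.\<close>
  have "1 \<le> (1 - y + y\<^sup>2) * (1 + y)" using y by (simp add: power2_eq_square algebra_simps)
  also have "\<dots> \<le> (1 - y + y\<^sup>2) * exp y" using y exp_ge_add_one_self[of y]
    by (intro mult_left_mono) (auto intro: add_nonneg_nonneg)
  finally have "exp (- y) \<le> 1 - y + y\<^sup>2" by (simp add: exp_minus field_simps)
  then show ?thesis by (simp add: y_def)
qed

text \<open>The variable is centred, so the linear terms of the quadratic bound cancel and only the
  variance \<open>p * (1 - p)\<close>, at most 1, is left.\<close>

lemma bernoulli_mgf_bound:
  fixes p l :: real
  assumes "0 \<le> p" "p \<le> 1" "\<bar>l\<bar> \<le> 1"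
  shows "p * exp (l * (1 - p)) + (1 - p) * exp (l * (0 - p)) \<le> exp (l\<^sup>2)"
proof -
  have "\<bar>l * (1 - p)\<bar> \<le> 1 * 1" "\<bar>l * (0 - p)\<bar> \<le> 1 * 1"
    unfolding abs_mult by (intro mult_mono; use assms in simp)+
  then have "exp (l * (1 - p)) \<le> 1 + l * (1 - p) + (l * (1 - p))\<^sup>2" "exp (l * (0 - p)) \<le> 1 + l * (0 - p) + (l * (0 - p))\<^sup>2"
    by (intro exp_le_quadratic; simp)+
  then have "p * exp (l * (1 - p)) + (1 - p) * exp (l * (0 - p))
    \<le> p * (1 + l * (1 - p) + (l * (1 - p))\<^sup>2) + (1 - p) * (1 + l * (0 - p) + (l * (0 - p))\<^sup>2)"
    using assms by (intro add_mono mult_left_mono) auto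
  also have "\<dots> = 1 + l\<^sup>2 * (p * (1 - p))" by (simp add: power2_eq_square algebra_simps)
  also have "\<dots> \<le> 1 + l\<^sup>2 * 1" using assms mult_mono[of p 1 "1 - p" 1] by (intro add_mono mult_left_mono) auto
  also have "\<dots> \<le> exp (l\<^sup>2)" using exp_ge_add_one_self[of "l\<^sup>2"] by simp
  finally show ?thesis .
qed

section \<open>Word probabilities\<close>

lemma length_sample [simp]: "length (sample X n \<omega>) = n"
  by (simp add: sample_def)

lemma sample_0 [simp]: "sample X 0 \<omega> = []"
  by (simp add: sample_def)

lemma sample_Suc: "sample X (Suc n) \<omega> = sample X n \<omega> @ [X (Suc n) \<omega>]"
  by (simp add: sample_def)

lemma nth_sample: "i < n \<Longrightarrow> sample X n \<omega> ! i = X (Suc i) \<omega>"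
  by (simp add: sample_def nth_append del: upt_Suc)

abbreviation words :: "nat \<Rightarrow> 'a::finite list set" where
  "words n \<equiv> {w. length w = n}"

lemma finite_words [simp]: "finite (words n :: 'a::finite list set)"
  using finite_lists_length_eq[of "UNIV :: 'a set" n] by simp

lemma sum_words_Suc:
  "(\<Sum>w\<in>words (Suc n). f w) = (\<Sum>w\<in>words n. \<Sum>c\<in>(UNIV::'a::finite set). f (w @ [c]))"
proof -
  have *: "w \<noteq> []" if "w \<in> words (Suc n)" for w :: "'a list"
    using that by auto
  have "bij_betw (\<lambda>(w, c). w @ [c]) (words n \<times> (UNIV :: 'a set)) (words (Suc n))"
    by (rule bij_betwI[where g = "\<lambda>w. (butlast w, last w)"]) (use append_butlast_last_id[OF *] in auto)
  from sum.reindex_bij_betw[OF this, of f] show ?thesis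
    by (simp add: sum.cartesian_product split_def)
qed

locale letter_process = prob_space P for P :: "'w measure" +
  fixes X :: "nat \<Rightarrow> 'w \<Rightarrow> 'a::finite"
  assumes X_measurable: "n \<ge> 1 \<Longrightarrow> X n \<in> measurable P (count_space UNIV)"
begin

lemma sample_measurable [measurable]: "sample X n \<in> measurable P (count_space UNIV)"
proof (induction n)
  case 0 then show ?case by (simp add: sample_def)
next
  case (Suc n)
  note this[measurable] X_measurable[of "Suc n", simplified, measurable]
  show ?case unfolding sample_Suc[abs_def] by measurable
qed

text \<open>Turns events about the first \<open>n\<close> letters into finite sums over words; the
  martingale estimates below can then be proved by induction on \<open>n\<close>, without
  conditional expectations.\<close>

lemma prob_sample:
  "prob {\<omega> \<in> space P. Q (sample X n \<omega>)} = (\<Sum>w | length w = n \<and> Q w. block_prob P X w)"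
proof -
  have "{\<omega> \<in> space P. Q (sample X n \<omega>)} = (\<Union>w\<in>{w. length w = n \<and> Q w}. {\<omega> \<in> space P. sample X n \<omega> = w})"
    by auto
  also have "prob \<dots> = (\<Sum>w | length w = n \<and> Q w. prob {\<omega> \<in> space P. sample X n \<omega> = w})"
    by (rule finite_measure_finite_Union)
      (auto simp: disjoint_family_on_def intro: finite_subset[OF _ finite_words[of n]])
  finally show ?thesis by (simp add: block_prob_def)
qed

lemma block_prob_nonneg [simp]: "0 \<le> block_prob P X a"
  by (simp add: block_prob_def)

lemma block_prob_Nil [simp]: "block_prob P X [] = 1"
  by (simp add: block_prob_def prob_space)

lemma next_prob_eq: "next_prob P X b a = block_prob P X (a @ [b]) / block_prob P X a"
  unfolding next_prob_def cond_prob_def block_prob_def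
  by (simp add: sample_Suc conj_commute)

lemma sum_block_prob_snoc: "(\<Sum>b\<in>UNIV. block_prob P X (a @ [b])) = block_prob P X a"
proof -
  note X_measurable[of "Suc (length a)", simplified, measurable]
  have "{\<omega> \<in> space P. sample X (length a) \<omega> = a} =
      (\<Union>b. {\<omega> \<in> space P. sample X (Suc (length a)) \<omega> = a @ [b]})"
    by (auto simp: sample_Suc)
  also have "prob \<dots> = (\<Sum>b\<in>UNIV. prob {\<omega> \<in> space P. sample X (Suc (length a)) \<omega> = a @ [b]})"
    by (rule finite_measure_finite_Union) (auto simp: disjoint_family_on_def)
  finally show ?thesis by (simp add: block_prob_def)
qed

lemma block_prob_snoc_le: "block_prob P X (a @ [b]) \<le> block_prob P X a"
  unfolding sum_block_prob_snoc[of a, symmetric] by (rule member_le_sum) auto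

lemma next_prob_bounds: "0 \<le> next_prob P X b a" "next_prob P X b a \<le> 1"
  using block_prob_snoc_le[of a b] by (auto simp: next_prob_eq divide_le_eq_1 less_le)

lemma block_prob_snoc: "block_prob P X (a @ [b]) = block_prob P X a * next_prob P X b a"
  using block_prob_snoc_le[of a b] block_prob_nonneg[of "a @ [b]"]
  by (cases "block_prob P X a = 0") (auto simp: next_prob_eq simp del: block_prob_nonneg)

text \<open>\<open>has_memory\<close> speaks only of words of positive probability. For a null word
  both sides are 0, so the factorization holds for every long enough word.\<close>

lemma block_prob_snoc_memory:
  assumes "has_memory P X m" "m \<le> length a"
  shows "block_prob P X (a @ [b]) = block_prob P X a * next_prob P X b (drop (length a - m) a)"
  using assms block_prob_snoc[of a b] unfolding has_memory_def
  by (cases "block_prob P X a > 0") (auto simp: less_le)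

lemma sum_next_prob: "block_prob P X a > 0 \<Longrightarrow> (\<Sum>b\<in>UNIV. next_prob P X b a) = 1"
  by (simp add: next_prob_eq sum_block_prob_snoc flip: sum_divide_distrib)

section \<open>Exponential moments of the deviations\<close>

text \<open>Each appended letter multiplies the exponential moment by at most
  \<open>exp (l\<^sup>2)\<close>: words not ending in \<open>a\<close> leave \<open>dev\<close>
  unchanged, the others add a centred Bernoulli increment.\<close>

lemma dev_mgf_bound:
  assumes mem: "has_memory P X m" and len: "m \<le> length a" and l: "\<bar>l\<bar> \<le> 1"
    and p: "p = next_prob P X c (drop (length a - m) a)"
  shows "(\<Sum>w\<in>words n. block_prob P X w * exp (l * dev p a c w)) \<le> exp (l\<^sup>2 * real n)"
proof (induction n)
  case 0 then show ?case by simp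
next
  case (Suc n)
  have p01: "0 \<le> p" "p \<le> 1" using next_prob_bounds p by auto
  have "(\<Sum>b\<in>UNIV. block_prob P X (w @ [b]) * exp (l * dev p a c (w @ [b])))
     \<le> block_prob P X w * exp (l * dev p a c w) * exp (l\<^sup>2)" for w
  proof (cases "suffix a w")
    case False
    then have "(\<Sum>b\<in>UNIV. block_prob P X (w @ [b]) * exp (l * dev p a c (w @ [b])))
      = block_prob P X w * exp (l * dev p a c w)"
      by (simp add: dev_snoc sum_block_prob_snoc flip: sum_distrib_right)
    then show ?thesis
      using mult_left_mono[of 1 "exp (l\<^sup>2)" "block_prob P X w * exp (l * dev p a c w)"] by simp
  next
    \<comment> \<open>Since \<open>a\<close> has at least \<open>m\<close> letters, \<open>w\<close>
      and \<open>a\<close> share their last \<open>m\<close> letters, so \<open>c\<close> follows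
      \<open>w\<close> with probability exactly \<open>p\<close>.\<close>
    case True
    then have *: "m \<le> length w" "drop (length w - m) w = drop (length a - m) a"
      using len by (auto elim!: suffixE)
    have "block_prob P X (w @ [c]) = block_prob P X w * p"
      using block_prob_snoc_memory[OF mem *(1), of c] * p by simp
    moreover from this have "(\<Sum>b\<in>UNIV - {c}. block_prob P X (w @ [b])) = block_prob P X w * (1 - p)"
      using sum_block_prob_snoc[of w] by (simp add: sum_diff1 algebra_simps)
    moreover have "(\<Sum>b\<in>UNIV. block_prob P X (w @ [b]) * exp (l * dev p a c (w @ [b])))
      = block_prob P X (w @ [c]) * exp (l * dev p a c w + l * (1 - p))
        + (\<Sum>b\<in>UNIV - {c}. block_prob P X (w @ [b])) * exp (l * dev p a c w + l * (0 - p))"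
      using True by (subst sum.remove[of _ c]) (auto simp: dev_snoc sum_distrib_left sum_distrib_right algebra_simps intro!: sum.cong)
    ultimately have "(\<Sum>b\<in>UNIV. block_prob P X (w @ [b]) * exp (l * dev p a c (w @ [b])))
      = block_prob P X w * exp (l * dev p a c w) * (p * exp (l * (1 - p)) + (1 - p) * exp (l * (0 - p)))"
      by (simp only: exp_add) (simp add: algebra_simps)
    also have "\<dots> \<le> block_prob P X w * exp (l * dev p a c w) * exp (l\<^sup>2)"
      by (intro mult_left_mono bernoulli_mgf_bound p01 l) simp
    finally show ?thesis .
  qed
  then have "(\<Sum>w\<in>words (Suc n). block_prob P X w * exp (l * dev p a c w))
      \<le> (\<Sum>w\<in>words n. block_prob P X w * exp (l * dev p a c w)) * exp (l\<^sup>2)"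
    unfolding sum_words_Suc sum_distrib_right by (rule sum_mono)
  also have "\<dots> \<le> exp (l\<^sup>2 * real n) * exp (l\<^sup>2)" by (rule mult_right_mono) (use Suc in auto)
  finally show ?case by (simp add: exp_add[symmetric] algebra_simps)
qed

text \<open>Chernoff's bound at half the threshold of the estimator; the sign \<open>s\<close>
  covers both tails.\<close>

lemma dev_tail_bound:
  assumes mem: "has_memory P X m" and len: "m \<le> length a"
    and p: "p = next_prob P X c (drop (length a - m) a)"
    and n: "n \<ge> 1" and s: "\<bar>s\<bar> = 1"
  shows "prob {\<omega> \<in> space P. real n powr (3/4) / 2 \<le> s * dev p a c (sample X n \<omega>)} \<le> exp (- sqrt n / 16)"
proof -
  define t where "t = real n powr (3/4) / 2"
  \<comment> \<open>This is \<open>t / (2 * n)\<close>, the minimizer of the exponent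
    \<open>l\<^sup>2 * n - l * t\<close>.\<close>
  define l where "l = real n powr (-1/4) / 4"
  have "real n powr (-1/4) \<le> 1" using n powr_mono2'[of "-1/4" 1 "real n"] by simp
  then have l1: "0 < l" "\<bar>l * s\<bar> \<le> 1" using n s by (auto simp: l_def abs_mult)
  have sq: "sqrt n = real n powr (1/2)" using n by (simp add: powr_half_sqrt)
  have lt: "l * t = sqrt n / 8"
    unfolding l_def t_def sq using n by (simp add: powr_add[symmetric])
  have "l\<^sup>2 = real n powr (-1/2) / 16"
    unfolding l_def using n by (simp add: power2_eq_square powr_add[symmetric])
  then have "l\<^sup>2 * n = real n powr (-1/2) * real n powr 1 / 16" using n by simp
  also have "\<dots> = sqrt n / 16" unfolding powr_add[symmetric] sq by simp
  finally have l2: "l\<^sup>2 * n = sqrt n / 16" .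
  have "prob {\<omega> \<in> space P. t \<le> s * dev p a c (sample X n \<omega>)}
      = (\<Sum>w | length w = n \<and> t \<le> s * dev p a c w. block_prob P X w)"
    by (rule prob_sample)
  also have "\<dots> \<le> (\<Sum>w | length w = n \<and> t \<le> s * dev p a c w. block_prob P X w * exp (l * (s * dev p a c w) - l * t))"
  proof (rule sum_mono)
    fix w assume "w \<in> {w. length w = n \<and> t \<le> s * dev p a c w}"
    then have "1 \<le> exp (l * (s * dev p a c w) - l * t)" using l1 by simp
    from mult_left_mono[OF this block_prob_nonneg[of w]]
    show "block_prob P X w \<le> block_prob P X w * exp (l * (s * dev p a c w) - l * t)" by simp
  qed
  also have "\<dots> \<le> (\<Sum>w\<in>words n. block_prob P X w * exp (l * (s * dev p a c w) - l * t))"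
    by (rule sum_mono2) auto
  also have "\<dots> = exp (- (l * t)) * (\<Sum>w\<in>words n. block_prob P X w * exp (l * s * dev p a c w))"
    unfolding sum_distrib_left by (rule sum.cong) (auto simp: exp_diff exp_minus field_simps)
  also have "\<dots> \<le> exp (- (l * t)) * exp ((l * s)\<^sup>2 * n)"
    by (intro mult_left_mono dev_mgf_bound[OF mem len l1(2) p]) simp
  also have "(l * s)\<^sup>2 * n = l\<^sup>2 * n" using s by (simp add: power_mult_distrib abs_square_eq_1)
  also have "exp (- (l * t)) * exp (l\<^sup>2 * n) = exp (- sqrt n / 16)"
    unfolding exp_add[symmetric] lt l2 by simp
  finally show ?thesis unfolding t_def .
qed

end

section \<open>The maximum over short words\<close>

text \<open>Used with \<open>c = cutoff n\<close>, where the bound is a power of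
  \<open>ln n\<close>.\<close>

lemma card_short_words:
  "real (card {a :: 'a::finite list. real (length a) < c}) \<le> real (Suc CARD('a)) powr c"
proof (cases "c < 0")
  case True
  then have "{a :: 'a list. real (length a) < c} = {}" by auto
  then show ?thesis by (simp only: card.empty) simp
next
  case False
  define K where "K = nat \<lfloor>c\<rfloor>"
  have "{a :: 'a list. real (length a) < c} \<subseteq> {a. set a \<subseteq> UNIV \<and> length a \<le> K}"
    unfolding K_def using False by (auto simp: le_nat_floor)
  then have "card {a :: 'a list. real (length a) < c} \<le> (\<Sum>i\<le>K. CARD('a) ^ i)"
    using card_mono[OF finite_lists_length_le[of "UNIV :: 'a set" K]] card_lists_length_le[of "UNIV :: 'a set" K]
    by simp
  also have "\<dots> \<le> Suc CARD('a) ^ K"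
  proof (induction K)
    case (Suc k)
    \<comment> \<open>The new summand is the alphabet size times its \<open>k\<close>-th power, and
      that power is at most the \<open>k\<close>-th power of the alphabet size plus one.\<close>
    have "(\<Sum>i\<le>Suc k. CARD('a) ^ i) \<le> Suc CARD('a) ^ k + CARD('a) * Suc CARD('a) ^ k"
      using Suc by (simp add: add_mono power_mono)
    then show ?case by simp
  qed simp
  finally have "real (card {a :: 'a list. real (length a) < c}) \<le> real (Suc CARD('a)) ^ K"
    by (metis of_nat_le_iff of_nat_power)
  also have "\<dots> = real (Suc CARD('a)) powr real K" by (simp add: powr_realpow)
  also have "\<dots> \<le> real (Suc CARD('a)) powr c"
    by (rule powr_mono) (use False in \<open>auto simp: K_def\<close>)
  finally show ?thesis .
qed

lemma finite_short_words: "finite {a :: 'a::finite list. real (length a) < c}"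
proof (rule finite_subset)
  show "{a :: 'a list. real (length a) < c} \<subseteq> {a. set a \<subseteq> UNIV \<and> length a \<le> nat \<lceil>c\<rceil>}"
    by auto linarith
qed (rule finite_lists_length_le, simp)

lemma finite_nat_less_real: "finite {k. Q k \<and> real k < c}"
  by (rule finite_subset[of _ "{..nat \<lceil>c\<rceil>}"]) (auto, linarith)

lemma words_nonempty: "words k \<noteq> ({} :: 'a::finite list set)"
  using Ex_list_of_length[of k] by auto

lemma phi_term_le_phi:
  assumes "m < length b" "real (length b) < cutoff (length w)"
  shows "phi_term m w b \<le> phi m w"
proof -
  let ?K = "{k. m < k \<and> real k < cutoff (length w)}"
  have "phi_term m w b \<le> Max (phi_term m w ` words (length b))"
    by (rule Max_ge) auto
  also have "\<dots> \<le> Max ((\<lambda>k. Max (phi_term m w ` words k)) ` ?K)"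
    by (rule Max_ge) (use assms finite_nat_less_real in auto)
  finally show ?thesis using assms unfolding phi_def Let_def by auto
qed

text \<open>Positivity of \<open>t\<close> rules out the empty range, where \<open>phi\<close> has
  the default value 0.\<close>

lemma phi_ge_imp_phi_term:
  assumes "t \<le> phi m w" "0 < t"
  shows "\<exists>b. m < length b \<and> real (length b) < cutoff (length w) \<and> t \<le> phi_term m w b"
proof -
  let ?K = "{k. m < k \<and> real k < cutoff (length w)}"
  have ne: "?K \<noteq> {}" using assms unfolding phi_def Let_def by (auto split: if_splits)
  then have "t \<le> Max ((\<lambda>k. Max (phi_term m w ` words k)) ` ?K)"
    using assms(1) by (simp only: phi_def Let_def if_False)
  then obtain k where k: "k \<in> ?K" "t \<le> Max (phi_term m w ` words k)"
    using ne finite_nat_less_real by (subst (asm) Max_ge_iff) auto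
  then obtain b where "length b = k" "t \<le> phi_term m w b"
    using words_nonempty by (subst (asm) Max_ge_iff) auto
  then show ?thesis using k by auto
qed

lemma order_estimator_eqI:
  assumes "real M < real (length w) - cutoff (length w)"
    and "phi M w < real (length w) powr (3/4)"
    and "\<And>m. m < M \<Longrightarrow> real (length w) powr (3/4) \<le> phi m w"
  shows "order_estimator w = M"
proof -
  let ?C = "{m. real m < real (length w) - cutoff (length w) \<and> phi m w < real (length w) powr (3/4)}"
  have "finite ?C"
    by (rule finite_subset[OF _ finite_nat_less_real[of "\<lambda>_. True" "real (length w) - cutoff (length w)"]]) auto
  then have Min: "Min ?C = M"
  proof (rule Min_eqI)
    fix m assume "m \<in> ?C"
    then show "M \<le> m" using assms(3)[of m] by (cases "m < M") auto
  qed (use assms(1,2) in simp)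
  have "M \<in> ?C" using assms(1,2) by simp
  then have ne: "?C \<noteq> {}" by blast
  show ?thesis unfolding order_estimator_def Let_def if_not_P[OF ne] by (fact Min)
qed

text \<open>Up to a constant, \<open>Q powr cutoff n\<close> times the exponential is a power of
  \<open>ln n\<close> times \<open>exp (- sqrt n / 16)\<close>, which decays faster than any power
  of \<open>n\<close>.\<close>

lemma summable_tail:
  assumes "Q > (1::real)"
  shows "summable (\<lambda>n. Q powr cutoff n * (2 * exp (- sqrt (real n) / 16)))"
proof (rule summable_comparison_test_bigo)
  show "summable (\<lambda>n. norm (real n powr -2))"
    using summable_real_powr_iff[of "-2"] by simp
  show "(\<lambda>n. Q powr cutoff n * (2 * exp (- sqrt (real n) / 16))) \<in> O(\<lambda>n. real n powr -2)"
    unfolding cutoff_def using assms by real_asymp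
qed

section \<open>Almost sure upper bound on \<open>phi\<close> under memory\<close>

context letter_process
begin

text \<open>Union bound over the short words \<open>b\<close>: a large term forces an upward
  deviation of \<open>butlast b\<close> or a downward one of its suffix of length \<open>m\<close>,
  each by half the threshold.\<close>

lemma prob_phi_large:
  assumes mem: "has_memory P X m" and n: "n \<ge> 1"
  shows "prob {\<omega> \<in> space P. real n powr (3/4) \<le> phi m (sample X n \<omega>)}
    \<le> real (Suc CARD('a)) powr cutoff n * (2 * exp (- sqrt (real n) / 16))"
proof -
  define t where "t = real n powr (3/4) / 2"
  have t: "0 < t" using n by (simp add: t_def)
  define W where "W = {b :: 'a list. m < length b \<and> real (length b) < cutoff n}"
  have W: "finite W" unfolding W_def by (rule finite_subset[OF _ finite_short_words[of "cutoff n"]]) auto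
  define s where "s b = drop (length (butlast b) - m) (butlast b)" for b :: "'a list"
  define p where "p b = next_prob P X (last b) (s b)" for b
  define E1 where "E1 b = {\<omega> \<in> space P. t \<le> 1 * dev (p b) (butlast b) (last b) (sample X n \<omega>)}" for b
  define E2 where "E2 b = {\<omega> \<in> space P. t \<le> - 1 * dev (p b) (s b) (last b) (sample X n \<omega>)}" for b
  have meas: "E1 b \<in> sets P" "E2 b \<in> sets P" for b unfolding E1_def E2_def by measurable
  have sub: "{\<omega> \<in> space P. real n powr (3/4) \<le> phi m (sample X n \<omega>)} \<subseteq> (\<Union>b\<in>W. E1 b \<union> E2 b)"
  proof
    fix \<omega> assume "\<omega> \<in> {\<omega> \<in> space P. real n powr (3/4) \<le> phi m (sample X n \<omega>)}"
    then have \<omega>: "\<omega> \<in> space P" "2 * t \<le> phi m (sample X n \<omega>)" by (auto simp: t_def)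
    then obtain b where b: "m < length b" "real (length b) < cutoff n" "2 * t \<le> phi_term m (sample X n \<omega>) b"
      using phi_ge_imp_phi_term[of "2 * t" m "sample X n \<omega>"] t by auto
    then have "b = butlast b @ [last b]" by (metis append_butlast_last_id gr_implies_not0 length_0_conv)
    moreover have "sample X n \<omega> \<noteq> []" using n by (metis length_sample list.size(3) not_one_le_zero)
    ultimately have "\<not> (dev (p b) (butlast b) (last b) (sample X n \<omega>) < t \<and> - t < dev (p b) (s b) (last b) (sample X n \<omega>))"
      using phi_term_le_dev[of "sample X n \<omega>" t "p b" "butlast b" "last b" m] b(3) t by (auto simp: s_def)
    then show "\<omega> \<in> (\<Union>b\<in>W. E1 b \<union> E2 b)" using b \<omega> unfolding W_def E1_def E2_def by auto
  qed
  have "prob {\<omega> \<in> space P. real n powr (3/4) \<le> phi m (sample X n \<omega>)} \<le> prob (\<Union>b\<in>W. E1 b \<union> E2 b)"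
    by (rule finite_measure_mono[OF sub]) (use W meas in auto)
  also have "\<dots> \<le> (\<Sum>b\<in>W. prob (E1 b \<union> E2 b))"
    by (rule finite_measure_subadditive_finite) (use W meas in auto)
  also have "\<dots> \<le> (\<Sum>b\<in>W. 2 * exp (- sqrt (real n) / 16))"
  proof (rule sum_mono)
    fix b assume "b \<in> W"
    then have len: "m \<le> length (butlast b)" by (auto simp: W_def)
    then have ls: "length (s b) = m" by (simp add: s_def)
    have "prob (E1 b) \<le> exp (- sqrt (real n) / 16)"
      unfolding E1_def t_def by (rule dev_tail_bound[OF mem len _ n]) (simp_all add: p_def s_def)
    \<comment> \<open>The word \<open>s b\<close> has length \<open>m\<close> and is its own suffix
      of that length, so \<open>p b\<close> is the centring required for it too.\<close>
    moreover have "prob (E2 b) \<le> exp (- sqrt (real n) / 16)"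
      unfolding E2_def t_def by (rule dev_tail_bound[OF mem _ _ n]) (simp_all add: p_def ls)
    moreover have "prob (E1 b \<union> E2 b) \<le> prob (E1 b) + prob (E2 b)"
      by (rule measure_Un_le) (use meas in auto)
    ultimately show "prob (E1 b \<union> E2 b) \<le> 2 * exp (- sqrt (real n) / 16)" by simp
  qed
  also have "\<dots> = real (card W) * (2 * exp (- sqrt (real n) / 16))" by simp
  also have "\<dots> \<le> real (Suc CARD('a)) powr cutoff n * (2 * exp (- sqrt (real n) / 16))"
  proof (rule mult_right_mono)
    have "card W \<le> card {b :: 'a list. real (length b) < cutoff n}"
      by (rule card_mono) (auto simp: W_def finite_short_words)
    then show "real (card W) \<le> real (Suc CARD('a)) powr cutoff n"
      using card_short_words[where 'a = 'a, of "cutoff n"] by linarith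
  qed simp
  finally show ?thesis .
qed

text \<open>The first Borel-Cantelli lemma applied to the summable bounds.\<close>

lemma AE_phi_eventually_small:
  assumes mem: "has_memory P X m"
  shows "AE \<omega> in P. \<forall>\<^sub>F n in sequentially. phi m (sample X n \<omega>) < real n powr (3/4)"
proof -
  define E where "E n = {\<omega> \<in> space P. real n powr (3/4) \<le> phi m (sample X n \<omega>)}" for n
  have "AE \<omega> in P. \<forall>\<^sub>F n in sequentially. \<omega> \<in> space P - E n"
  proof (rule borel_cantelli_AE1)
    show "E n \<in> sets P" for n unfolding E_def by measurable
    show "emeasure P (E n) < \<infinity>" for n by (simp add: less_top[symmetric])
    show "summable (\<lambda>n. prob (E n))"
    proof (rule summable_comparison_test_ev[OF _ summable_tail])
      show "\<forall>\<^sub>F n in sequentially. norm (prob (E n)) \<le> real (Suc CARD('a)) powr cutoff n * (2 * exp (- sqrt (real n) / 16))"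
        using eventually_ge_at_top[of 1] by eventually_elim (use prob_phi_large[OF mem] in \<open>simp add: E_def\<close>)
    qed simp
  qed
  then show ?thesis
    by (auto elim!: eventually_mono simp: E_def not_le)
qed

section \<open>Markov order zero\<close>

text \<open>Independence factors the probability over times; identical distribution moves every
  factor to time 1.\<close>

lemma block_prob_iid:
  assumes "iid P X"
  shows "block_prob P X a = (\<Prod>i<length a. block_prob P X [a ! i])"
proof (cases "a = []")
  case False
  have ind: "indep_vars (\<lambda>_. count_space UNIV) X {1..}"
    and same: "\<And>n. n \<ge> 1 \<Longrightarrow> distr P (count_space UNIV) (X n) = distr P (count_space UNIV) (X 1)"
    using assms unfolding iid_def by blast+
  have marg: "prob (X j -` {c} \<inter> space P) = block_prob P X [c]" if "j \<ge> 1" for j c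
  proof -
    have "prob (X j -` {c} \<inter> space P) = prob (X 1 -` {c} \<inter> space P)"
      using same[OF that] measure_distr[OF X_measurable[OF that], of "{c}"] measure_distr[OF X_measurable[of 1], of "{c}"]
      by simp
    also have "X 1 -` {c} \<inter> space P = {\<omega> \<in> space P. sample X (length [c]) \<omega> = [c]}"
      by (auto simp: sample_def)
    finally show ?thesis by (simp add: block_prob_def)
  qed
  have "{\<omega> \<in> space P. sample X (length a) \<omega> = a} = (\<Inter>j\<in>{1..length a}. X j -` {a ! (j - 1)} \<inter> space P)"
  proof (intro set_eqI iffI)
    fix \<omega> assume "\<omega> \<in> {\<omega> \<in> space P. sample X (length a) \<omega> = a}"
    then have \<omega>: "\<omega> \<in> space P" "sample X (length a) \<omega> = a" by auto
    have "X j \<omega> = a ! (j - 1)" if "j \<in> {1..length a}" for j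
      using nth_sample[of "j - 1" "length a" X \<omega>] that \<omega> by auto
    then show "\<omega> \<in> (\<Inter>j\<in>{1..length a}. X j -` {a ! (j - 1)} \<inter> space P)" using \<omega> by auto
  next
    fix \<omega> assume \<omega>: "\<omega> \<in> (\<Inter>j\<in>{1..length a}. X j -` {a ! (j - 1)} \<inter> space P)"
    have "X (Suc i) \<omega> = a ! i" if "i < length a" for i
      using bspec[OF INT_E[OF \<omega>, of "Suc i"]] \<omega> that by force
    then have "sample X (length a) \<omega> = a" by (intro nth_equalityI) (auto simp: nth_sample)
    moreover have "\<omega> \<in> space P" using \<omega> False by (auto simp: Suc_le_eq)
    ultimately show "\<omega> \<in> {\<omega> \<in> space P. sample X (length a) \<omega> = a}" by simp
  qed
  then have "block_prob P X a = prob (\<Inter>j\<in>{1..length a}. X j -` {a ! (j - 1)} \<inter> space P)"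
    by (simp add: block_prob_def)
  also have "\<dots> = (\<Prod>j\<in>{1..length a}. prob (X j -` {a ! (j - 1)} \<inter> space P))"
    by (rule indep_varsD[OF ind]) (use False in \<open>auto simp: Suc_le_eq\<close>)
  also have "\<dots> = (\<Prod>j\<in>{1..length a}. block_prob P X [a ! (j - 1)])"
    by (rule prod.cong) (auto simp: marg)
  also have "\<dots> = (\<Prod>i<length a. block_prob P X [a ! i])"
    by (rule prod.reindex_bij_witness[of _ Suc "\<lambda>j. j - 1"]) auto
  finally show ?thesis .
qed simp

text \<open>Order 0 is defined through \<open>iid\<close>, whereas the estimates use
  \<open>has_memory\<close>; the product formula links them.\<close>

lemma iid_imp_has_memory_0:
  assumes "iid P X"
  shows "has_memory P X 0"
proof -
  have "block_prob P X (a @ [b]) = block_prob P X a * block_prob P X [b]" for a b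
    unfolding block_prob_iid[OF assms, of "a @ [b]"] block_prob_iid[OF assms, of a]
    by (simp add: nth_append)
  then show ?thesis by (simp add: has_memory_def next_prob_eq less_le)
qed

text \<open>For positive order the minimality clause covers only \<open>0 < m\<close>; this
  implication excludes \<open>m = 0\<close> because the process is then not \<open>iid\<close>. Word
  probabilities multiply letter by letter with the law of \<open>X 1\<close> as factor, which yields
  both independence and equal marginals.\<close>

lemma has_memory_0_imp_iid:
  assumes mem: "has_memory P X 0"
  shows "iid P X"
proof -
  define q where "q A = (\<Sum>c\<in>A. block_prob P X [c])" for A
  have snoc: "block_prob P X (a @ [c]) = block_prob P X a * block_prob P X [c]" for a c
    using block_prob_snoc_memory[OF mem, of a c] by (simp add: next_prob_eq)
  have prod: "prob {\<omega> \<in> space P. \<forall>i<n. X (Suc i) \<omega> \<in> A i} = (\<Prod>i<n. q (A i))" for n and A :: "nat \<Rightarrow> 'a set"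
  proof -
    have "(\<Sum>w | length w = n \<and> (\<forall>i<n. w ! i \<in> A i). block_prob P X w) = (\<Prod>i<n. q (A i))"
    proof (induction n)
      case 0 then show ?case by (simp cong: conj_cong)
    next
      case (Suc n)
      have "(\<Sum>w | length w = Suc n \<and> (\<forall>i<Suc n. w ! i \<in> A i). block_prob P X w)
        = (\<Sum>w\<in>words (Suc n). if \<forall>i<Suc n. w ! i \<in> A i then block_prob P X w else 0)"
        by (simp add: sum.inter_filter[symmetric])
      also have "\<dots> = (\<Sum>w\<in>words n. \<Sum>c\<in>UNIV. (if \<forall>i<n. w ! i \<in> A i then block_prob P X w else 0) * (if c \<in> A n then block_prob P X [c] else 0))"
        unfolding sum_words_Suc
        by (intro sum.cong refl) (auto simp: snoc nth_append less_Suc_eq)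
      also have "\<dots> = (\<Sum>w | length w = n \<and> (\<forall>i<n. w ! i \<in> A i). block_prob P X w) * q (A n)"
        by (simp add: sum_product[symmetric] q_def sum.inter_filter[symmetric])
      finally show ?case using Suc by simp
    qed
    moreover have "{\<omega> \<in> space P. \<forall>i<n. X (Suc i) \<omega> \<in> A i} = {\<omega> \<in> space P. \<forall>i<n. sample X n \<omega> ! i \<in> A i}"
      by (auto simp: nth_sample)
    ultimately show ?thesis using prob_sample[of "\<lambda>w. \<forall>i<n. w ! i \<in> A i" n] by simp
  qed
  have q1: "q UNIV = 1" unfolding q_def using sum_block_prob_snoc[of "[]"] by simp
  have fin: "prob (\<Inter>j\<in>J. X j -` B j \<inter> space P) = (\<Prod>j\<in>J. q (B j))"
    if J: "finite J" "J \<noteq> {}" "J \<subseteq> {1..}" for J B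
  proof -
    \<comment> \<open>Times missing from \<open>J\<close> are filled with the whole alphabet, whose
      factor is 1; this reduces any finite set of times to an initial segment.\<close>
    define A where "A i = (if Suc i \<in> J then B (Suc i) else UNIV)" for i
    have ltM: "i < Max J" if "Suc i \<in> J" for i using Max_ge[OF J(1) that] by simp
    have pos: "\<exists>i. j = Suc i" if "j \<in> J" for j using J(3) that by (cases j) auto
    have "(\<Inter>j\<in>J. X j -` B j \<inter> space P) = {\<omega> \<in> space P. \<forall>i<Max J. X (Suc i) \<omega> \<in> A i}"
    proof (intro set_eqI iffI)
      fix \<omega> assume "\<omega> \<in> (\<Inter>j\<in>J. X j -` B j \<inter> space P)"
      then show "\<omega> \<in> {\<omega> \<in> space P. \<forall>i<Max J. X (Suc i) \<omega> \<in> A i}"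
        using J(2) by (auto simp: A_def)
    next
      fix \<omega> assume \<omega>: "\<omega> \<in> {\<omega> \<in> space P. \<forall>i<Max J. X (Suc i) \<omega> \<in> A i}"
      have "X j \<omega> \<in> B j" if j: "j \<in> J" for j
      proof -
        obtain i where i: "j = Suc i" using pos[OF j] by blast
        then have "X (Suc i) \<omega> \<in> A i" using \<omega> ltM j by blast
        then show ?thesis using i j by (simp add: A_def)
      qed
      with \<omega> show "\<omega> \<in> (\<Inter>j\<in>J. X j -` B j \<inter> space P)" by simp
    qed
    then have "prob (\<Inter>j\<in>J. X j -` B j \<inter> space P) = (\<Prod>i<Max J. q (A i))" by (simp add: prod)
    also have "\<dots> = (\<Prod>i | Suc i \<in> J. q (B (Suc i)))"
      by (rule prod.mono_neutral_cong_right) (auto simp: A_def q1 ltM)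
    also have "\<dots> = (\<Prod>j\<in>J. q (B j))"
      by (rule prod.reindex_bij_witness[of _ "\<lambda>j. j - 1" Suc]) (use pos in force)+
    finally show ?thesis .
  qed
  have marg: "prob (X j -` B \<inter> space P) = q B" if "j \<ge> 1" for j B
    using fin[of "{j}" "\<lambda>_. B"] that by simp
  have "indep_vars (\<lambda>_. count_space UNIV) X {1..}"
    unfolding indep_vars_def2
  proof (intro conjI ballI indep_setsI)
    fix A J assume J: "J \<noteq> {}" "J \<subseteq> {1::nat..}" "finite J"
      and A: "\<forall>j\<in>J. A j \<in> {X j -` B \<inter> space P |B. B \<in> sets (count_space UNIV)}"
    then obtain B where B: "\<And>j. j \<in> J \<Longrightarrow> A j = X j -` B j \<inter> space P"
      by (simp, metis)
    have "prob (\<Inter>j\<in>J. A j) = (\<Prod>j\<in>J. q (B j))" using fin[OF J(3,1,2), of B] B by simp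
    also have "\<dots> = (\<Prod>j\<in>J. prob (A j))" by (rule prod.cong) (use B J marg in auto)
    finally show "prob (\<Inter>j\<in>J. A j) = (\<Prod>j\<in>J. prob (A j))" .
  qed (use X_measurable in \<open>auto intro: measurable_sets\<close>)
  moreover have "distr P (count_space UNIV) (X n) = distr P (count_space UNIV) (X 1)" if "n \<ge> 1" for n
    by (rule measure_eqI)
      (use that in \<open>simp_all add: emeasure_distr X_measurable emeasure_eq_measure marg marg[of 1, simplified]\<close>)
  ultimately show ?thesis unfolding iid_def by blast
qed

text \<open>All that the consistency argument uses of the order: \<open>M\<close> is the least
  memory length, with 0 included in the comparison.\<close>

lemma markov_of_order_memory:
  assumes "markov_of_order P X M"
  shows "has_memory P X M" and "m < M \<Longrightarrow> \<not> has_memory P X m"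
proof -
  show "has_memory P X M"
    using assms iid_imp_has_memory_0 by (auto simp: markov_of_order_def split: if_splits)
  show "m < M \<Longrightarrow> \<not> has_memory P X m"
    using assms has_memory_0_imp_iid by (cases "m = 0") (auto simp: markov_of_order_def split: if_splits)
qed

end

section \<open>Block frequencies\<close>

lemma funpow_shift: "(shift ^^ i) x = (\<lambda>j. x (i + j))"
  by (induction i arbitrary: x) (auto simp: shift_def funpow_Suc_right simp del: funpow.simps)

text \<open>Writes the count as an ergodic sum of a cylinder indicator along the shift; a block has
  \<open>Suc n - length a\<close> possible starting points.\<close>

lemma block_count_sample:
  assumes "n \<le> N" "length a \<le> n"
  shows "real (block_count n (sample X N \<omega>) a)
    = (\<Sum>i<Suc n - length a. indicator {x. \<forall>j<length a. x j = a ! j} ((shift ^^ i) (\<lambda>i. X (Suc i) \<omega>)))"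
proof -
  have "take (length a) (drop i (sample X N \<omega>)) = a \<longleftrightarrow> (\<forall>j<length a. X (Suc (i + j)) \<omega> = a ! j)"
    if "i < Suc n - length a" for i
    using that assms by (auto simp: list_eq_iff_nth_eq nth_sample)
  then have "{i. i + length a \<le> n \<and> take (length a) (drop i (sample X N \<omega>)) = a}
    = {i \<in> {..<Suc n - length a}. \<forall>j<length a. X (Suc (i + j)) \<omega> = a ! j}"
    by (auto simp: less_diff_conv)
  then show ?thesis
    unfolding block_count_def by (simp add: funpow_shift indicator_def sum.If_cases Int_def)
qed

context letter_process
begin

lemma seq_map_measurable: "(\<lambda>\<omega> i. X (Suc i) \<omega>) \<in> measurable P seq_space"
  unfolding seq_space_def
  by (rule measurable_PiM_single') (auto simp: X_measurable space_PiM)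

text \<open>The ergodic theorem on the sequence space, applied to a cylinder and pulled back to
  \<open>P\<close>. There are only countably many words, so one null set serves them all.\<close>

lemma AE_block_frequencies:
  assumes stat: "stationary P X" and erg: "ergodic P X"
  shows "AE \<omega> in P. \<forall>a. (\<lambda>n. real (block_count n (sample X n \<omega>) a) / real n) \<longlonglongrightarrow> block_prob P X a"
  unfolding AE_all_countable
proof
  fix a :: "'a list"
  define C where "C = {x. \<forall>j<length a. x j = a ! j}"
  have space: "space (seq_space :: (nat \<Rightarrow> 'a) measure) = UNIV" by (simp add: seq_space_def space_PiM)
  have C_eq: "C = {x \<in> space seq_space. \<forall>j\<in>{..<length a}. x j \<in> {a ! j}}"
    by (auto simp: C_def space)
  have C: "C \<in> sets seq_space"
    unfolding C_eq unfolding seq_space_def by measurable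
  define Q where "Q = process_distr P X"
  interpret Q: prob_space Q
    unfolding Q_def process_distr_def by (rule prob_space_distr[OF seq_map_measurable])
  have Q_sets [measurable_cong]: "sets Q = sets seq_space" by (simp add: Q_def process_distr_def)
  have Q_space: "space Q = UNIV" by (simp add: Q_def process_distr_def space)
  have shift_meas: "shift \<in> measurable seq_space seq_space"
    unfolding seq_space_def shift_def[abs_def]
    by (rule measurable_PiM_single') (auto simp: space_PiM)
  have T: "shift \<in> measurable Q Q" using shift_meas Q_sets by (simp cong: measurable_cong_sets)
  have "distr Q Q shift = distr Q seq_space shift" by (rule distr_cong[OF refl Q_sets refl])
  then have inv: "distr Q Q shift = Q" using stat unfolding stationary_def Q_def by metis
  have int: "integrable Q (indicator C :: _ \<Rightarrow> real)"
    by (rule integrable_real_indicator) (simp_all add: C Q_sets Q.emeasure_eq_measure)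
  have erg': "measure Q B = 0 \<or> measure Q B = 1" if "B \<in> sets Q" "shift -` B \<inter> space Q = B" for B
  proof -
    have "B \<in> sets seq_space" "shift -` B = B" using that by (simp_all add: Q_sets Q_space)
    then show ?thesis using erg unfolding ergodic_def Q_def[symmetric] by blast
  qed
  have "measure Q C = prob ((\<lambda>\<omega> i. X (Suc i) \<omega>) -` C \<inter> space P)"
    unfolding Q_def process_distr_def by (rule measure_distr[OF seq_map_measurable C])
  also have "(\<lambda>\<omega> i. X (Suc i) \<omega>) -` C \<inter> space P = {\<omega> \<in> space P. sample X (length a) \<omega> = a}"
    by (auto simp: C_def list_eq_iff_nth_eq nth_sample)
  also have "prob \<dots> = block_prob P X a" by (simp add: block_prob_def)
  finally have mean: "(\<integral>x. indicat_real C x \<partial>Q) = block_prob P X a" by (simp add: Q_space)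
  have "AE x in Q. (\<lambda>n. (\<Sum>i<n. indicat_real C ((shift ^^ i) x)) / real n) \<longlonglongrightarrow> (\<integral>x. indicat_real C x \<partial>Q)"
    by (rule Q.birkhoff_ergodic[where f = "indicat_real C" and T = shift, OF T inv _ int]) (rule erg')
  then have "AE \<omega> in P. (\<lambda>n. (\<Sum>i<n. indicat_real C ((shift ^^ i) (\<lambda>i. X (Suc i) \<omega>))) / real n) \<longlonglongrightarrow> block_prob P X a"
    unfolding mean unfolding Q_def process_distr_def by (rule AE_distrD[OF seq_map_measurable])
  then show "AE \<omega> in P. (\<lambda>n. real (block_count n (sample X n \<omega>) a) / real n) \<longlonglongrightarrow> block_prob P X a"
  proof eventually_elim
    case (elim \<omega>)
    define S where "S n = (\<Sum>i<n. indicat_real C ((shift ^^ i) (\<lambda>i. X (Suc i) \<omega>)))" for n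
    define l where "l = length a"
    \<comment> \<open>A sample of \<open>n + l\<close> letters has \<open>n + 1\<close> starting
      points for a block of length \<open>l\<close>; shifting the index by \<open>l\<close> avoids
      truncated subtraction.\<close>
    have "(\<lambda>n. S (Suc n) / real (Suc n)) \<longlonglongrightarrow> block_prob P X a"
      using elim by (intro LIMSEQ_Suc) (simp add: S_def)
    moreover have "(\<lambda>n. real (Suc n) / real (n + l)) \<longlonglongrightarrow> 1" by real_asymp
    ultimately have "(\<lambda>n. S (Suc n) / real (Suc n) * (real (Suc n) / real (n + l))) \<longlonglongrightarrow> block_prob P X a * 1"
      by (rule tendsto_mult)
    also have "(\<lambda>n. S (Suc n) / real (Suc n) * (real (Suc n) / real (n + l)))
        = (\<lambda>n. real (block_count (n + l) (sample X (n + l) \<omega>) a) / real (n + l))"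
      by (rule ext) (simp add: block_count_sample l_def S_def C_def Suc_diff_le)
    finally show ?case by (simp add: LIMSEQ_offset[of _ l])
  qed
qed

section \<open>Linear growth of \<open>phi\<close> without memory\<close>

text \<open>One fixed word violating the memory condition suffices: its term divided by
  \<open>n\<close> has a positive limit, so it outgrows \<open>n powr (3/4)\<close>.\<close>

lemma phi_eventually_large:
  assumes freq: "\<And>a. (\<lambda>n. real (block_count n (sample X n \<omega>) a) / real n) \<longlonglongrightarrow> block_prob P X a"
    and mem: "\<not> has_memory P X m"
  shows "\<forall>\<^sub>F n in sequentially. real n powr (3/4) \<le> phi m (sample X n \<omega>)"
proof -
  obtain a b0 where a: "m \<le> length a" "0 < block_prob P X a"
    and b0: "next_prob P X b0 a \<noteq> next_prob P X b0 (drop (length a - m) a)"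
    using mem unfolding has_memory_def by blast
  define s where "s = drop (length a - m) a"
  \<comment> \<open>The first \<open>n - 1\<close> letters form the sample of length
    \<open>n - 1\<close>, so dropping the last letter does not change the limiting
    frequency.\<close>
  have freq': "(\<lambda>n. real (block_count (n - 1) (sample X n \<omega>) c) / real n) \<longlonglongrightarrow> block_prob P X c" for c
  proof -
    have eq: "block_count n (sample X (Suc n) \<omega>) c = block_count n (sample X n \<omega>) c" for n
    proof -
      have "take (length c) (drop i (sample X (Suc n) \<omega>)) = take (length c) (drop i (sample X n \<omega>))"
        if "i + length c \<le> n" for i
        using that by (simp add: sample_Suc)
      then show ?thesis unfolding block_count_def by (metis (no_types, lifting))
    qed
    have "(\<lambda>n. real n / real (Suc n)) \<longlonglongrightarrow> 1" by real_asymp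
    from tendsto_mult[OF freq[of c] this]
    have "(\<lambda>n. real (block_count n (sample X n \<omega>) c) / real n * (real n / real (Suc n))) \<longlonglongrightarrow> block_prob P X c"
      by simp
    moreover have "\<forall>\<^sub>F n in sequentially. real (block_count n (sample X n \<omega>) c) / real n * (real n / real (Suc n))
        = real (block_count n (sample X (Suc n) \<omega>) c) / real (Suc n)"
      using eventually_gt_at_top[of 0] by eventually_elim (simp add: eq)
    ultimately have "(\<lambda>n. real (block_count n (sample X (Suc n) \<omega>) c) / real (Suc n)) \<longlonglongrightarrow> block_prob P X c"
      by (rule Lim_transform_eventually)
    then show ?thesis by (subst filterlim_sequentially_Suc[symmetric]) simp
  qed
  \<comment> \<open>The comparison of counts passes to the limiting frequencies.\<close>
  have "block_prob P X a \<le> block_prob P X s"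
  proof (rule LIMSEQ_le[OF freq' freq'])
    have "real (block_count (n - 1) (sample X n \<omega>) a) / real n \<le> real (block_count (n - 1) (sample X n \<omega>) s) / real n"
      if "n \<ge> 1" for n
      using that block_count_mono_suffix[of "n - 1" "sample X n \<omega>" s a]
      by (intro divide_right_mono) (auto simp: s_def suffix_drop)
    then show "\<exists>N. \<forall>n\<ge>N. real (block_count (n - 1) (sample X n \<omega>) a) / real n \<le> real (block_count (n - 1) (sample X n \<omega>) s) / real n"
      by blast
  qed
  with a have s_pos: "0 < block_prob P X s" by simp
  \<comment> \<open>The discrepancy at \<open>b0\<close> may be negative, but \<open>phi\<close>
    detects only positive ones. Both conditional laws sum to 1, so some letter has a positive
    discrepancy.\<close>
  have "\<exists>b. next_prob P X b s < next_prob P X b a"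
  proof (rule ccontr)
    assume "\<not> ?thesis"
    then have le: "\<And>b. next_prob P X b a \<le> next_prob P X b s" by (auto simp: not_less)
    have "next_prob P X b0 a = next_prob P X b0 s"
      by (rule sum_mono_inv[of "\<lambda>b. next_prob P X b a" UNIV "\<lambda>b. next_prob P X b s"])
        (use le sum_next_prob[OF s_pos] sum_next_prob[OF a(2)] in auto)
    with b0 show False by (simp add: s_def)
  qed
  then obtain b where b: "next_prob P X b s < next_prob P X b a" by blast
  define \<delta> where "\<delta> = (next_prob P X b a - next_prob P X b s) * block_prob P X a"
  have \<delta>: "0 < \<delta>" using a b by (simp add: \<delta>_def)
  have ratio: "(\<lambda>n. (real (block_count n (sample X n \<omega>) (c @ [b])) / real n)
      / (real (block_count (n - 1) (sample X n \<omega>) c) / real n)) \<longlonglongrightarrow> next_prob P X b c"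
    if "0 < block_prob P X c" for c
    unfolding next_prob_eq using that by (intro tendsto_divide freq freq') simp
  have "(\<lambda>n. ((real (block_count n (sample X n \<omega>) (a @ [b])) / real n)
      / (real (block_count (n - 1) (sample X n \<omega>) a) / real n)
      - (real (block_count n (sample X n \<omega>) (s @ [b])) / real n)
      / (real (block_count (n - 1) (sample X n \<omega>) s) / real n))
      * (real (block_count (n - 1) (sample X n \<omega>) a) / real n)) \<longlonglongrightarrow> \<delta>"
    unfolding \<delta>_def by (intro tendsto_mult tendsto_diff ratio freq' a s_pos)
  moreover have "\<forall>\<^sub>F n in sequentially. ((real (block_count n (sample X n \<omega>) (a @ [b])) / real n)
      / (real (block_count (n - 1) (sample X n \<omega>) a) / real n)
      - (real (block_count n (sample X n \<omega>) (s @ [b])) / real n)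
      / (real (block_count (n - 1) (sample X n \<omega>) s) / real n))
      * (real (block_count (n - 1) (sample X n \<omega>) a) / real n) = phi_term m (sample X n \<omega>) (a @ [b]) / real n"
    using eventually_gt_at_top[of 0]
    by eventually_elim (simp add: phi_term_def emp_prob_def s_def)
  ultimately have "(\<lambda>n. phi_term m (sample X n \<omega>) (a @ [b]) / real n) \<longlonglongrightarrow> \<delta>"
    by (rule Lim_transform_eventually)
  then have "\<forall>\<^sub>F n in sequentially. \<delta> / 2 < phi_term m (sample X n \<omega>) (a @ [b]) / real n"
    by (rule order_tendstoD) (use \<delta> in simp)
  moreover have "\<forall>\<^sub>F n in sequentially. real n powr (3/4) \<le> \<delta> / 2 * real n"
    using \<delta> by real_asymp
  \<comment> \<open>The cutoff tends to infinity, so \<open>a @ [b]\<close> eventually lies within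
    the range of the maximum.\<close>
  moreover have "\<forall>\<^sub>F n in sequentially. real (Suc (length a)) < cutoff n"
    unfolding cutoff_def by real_asymp
  ultimately show ?thesis
    using eventually_gt_at_top[of 0]
  proof eventually_elim
    case (elim n)
    then have "\<delta> / 2 * real n < phi_term m (sample X n \<omega>) (a @ [b])"
      by (simp add: field_simps)
    also have "\<dots> \<le> phi m (sample X n \<omega>)"
      by (rule phi_term_le_phi) (use elim a in auto)
    finally show ?case using elim by linarith
  qed
qed

text \<open>Almost surely, from some \<open>n\<close> on, each of the finitely many
  \<open>m < M\<close> fails the threshold and \<open>M\<close> passes it, so the estimator is
  eventually equal to \<open>M\<close>.\<close>

lemma AE_order_estimator_tendsto:
  assumes stat: "stationary P X" and erg: "ergodic P X" and order: "markov_of_order P X M"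
  shows "AE \<omega> in P. (\<lambda>n. real (order_estimator (sample X n \<omega>))) \<longlonglongrightarrow> real M"
  using AE_block_frequencies[OF stat erg] AE_phi_eventually_small[OF markov_of_order_memory(1)[OF order]]
proof eventually_elim
  case (elim \<omega>)
  have "\<forall>\<^sub>F n in sequentially. \<forall>m\<in>{..<M}. real n powr (3/4) \<le> phi m (sample X n \<omega>)"
    by (rule eventually_ball_finite) (use phi_eventually_large elim(1) markov_of_order_memory(2)[OF order] in auto)
  moreover have "\<forall>\<^sub>F n in sequentially. real M < real n - cutoff n"
    unfolding cutoff_def by real_asymp
  ultimately have "\<forall>\<^sub>F n in sequentially. real (order_estimator (sample X n \<omega>)) = real M"
    using elim(2) by eventually_elim (auto intro!: order_estimator_eqI)
  then show ?case by (rule tendsto_eventually)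
qed

end

theorem theorem2:
  fixes P :: "'w measure" and X :: "nat \<Rightarrow> 'w \<Rightarrow> 'a::finite" and M :: nat
  assumes "is_process P X"
    and "stationary P X"
    and "ergodic P X"
    and "markov_of_order P X M"
  shows "AE \<omega> in P. (\<lambda>n. real (order_estimator (sample X n \<omega>))) \<longlonglongrightarrow> real M"
proof -
  interpret prob_space P using assms(1) by (simp add: is_process_def)
  interpret letter_process P X by unfold_locales (use assms(1) in \<open>simp add: is_process_def\<close>)
  show ?thesis using assms(2-4) by (rule AE_order_estimator_tendsto)
qed

end
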